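(* Let $G$ be a weighted digraph with vertex set $V$, $|V|=n$, and random walk Laplacian $\mathcal{L}=I-S$. Let $\alpha>0$ and $\beta=\frac1{1+\alpha}\in(0,1)$. Let $\wp$ be the pagerank vector of $G$, i.e. the row vector with $\wp(v)=2\tilde I(b_v)-\frac1n$ for $v\in V$, where $\tilde I(b_v)$ is the influence of the vertex $b_v$ in the extended graph $E_\alpha[G]$. Then $\wp$ is the (unique) probability measure on $V$ (row vector with nonnegative entries summing to $1$) that satisfies $$\wp=\wp\left(\beta S+\frac{1-\beta}{n}J\right)=\beta\,\wp S+\frac{1-\beta}{n}\mathbf 1^T,$$ where $J$ is the $n\times n$ all-ones matrix and $\mathbf 1\in\mathbb{R}^n$ is the all-ones column vector.
   Context: $G$ is a weakly connected (underlying undirected graph connected) weighted directed graph on $V=\{1,\dots,n\}$ with edge set $E\subseteq V\times V$; $ji\in E$ denotes an edge $j\to i$ with weight $w_{ji}>0$. The adjacency matrix $Q$ has $Q_{ij}=w_{ji}$ if $ji\in E$ and $0$ otherwise. The row stochastic matrix $S$ is obtained by first replacing $Q_{ii}$ by $1$ in every zero row $i$ of $Q$ and then dividing each row by its sum. General notions, for a digraph with $N$ vertices and associated row stochastic matrix $A$ (for $i\neq j$: edge $j\to i$ iff $A_{ij}>0$): the reachable set $R(j)$ is $j$ together with all vertices reachable from $j$ by a directed path; a reach is an inclusion-maximal reachable set; let $R_1,\dots,R_k$ be the distinct reaches, $H_i=R_i\setminus\bigcup_{j\ne i}R_j$ the exclusive part, $C_i=R_i\setminus H_i$ the common part, and the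 cabal $B_i$ the set of $r\in R_i$ with $R(r)=R_i$. The right kernel of $I-A$ has a basis of column vectors $\gamma_1,\dots,\gamma_k$ with $\gamma_i=1$ on $H_i$, $\gamma_i\in(0,1)$ on $C_i$, $\gamma_i=0$ off $R_i$, $\sum_i\gamma_i=\mathbf 1$; the left kernel has a basis of row vectors $\bar\gamma_1,\dots,\bar\gamma_k$ that are nonnegative, have support $B_i$, and have entries summing to $1$. Let $\Gamma^0$ be the matrix with columns $\gamma_i$ and $\bar\Gamma^0$ the matrix with rows $\bar\gamma_i$. The influence of a vertex $v$ is $\frac1N\mathbf 1^T\,\Gamma^0\bar\Gamma^0\,\mathbf 1_{\{v\}}$, where $\mathbf 1_{\{v\}}$ is the standard basis column vector at $v$. Extended graph $E_\alpha[G]$ (for $\alpha>0$): start with the graph on $V$ with weighted adjacency matrix $S$, and for each $v\in V$ add one new vertex $b_v$ and one new edge $b_v\to v$ of weight $\alpha$. It has $2n$ vertices, and with the ordering $b_1,\dots,b_n,1,\dots,n$ its row stochastic matrix is $$\tilde S=\begin{pmatrix} I&0\\ \frac{\alpha}{1+\alpha}I&\frac1{1+\alpha}S\end{pmatrix}.$$ Its reaches are exactly $R(b_1),\dots,R(b_n)$. $\tilde I(b_v)$ denotes the influence of $b_v$ in $E_\alpha[G]$ (with $N=2n$, $A=\tilde S$). *)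

theory Defs
  imports "HOL-Analysis.Analysis"
begin

text \<open>
  A weighted digraph on a finite vertex type is given by its edge set \<open>E\<close>, where \<open>(j, i) \<in> E\<close>
  is an edge from \<open>j\<close> to \<open>i\<close> (loops are allowed), and its weights \<open>w j i\<close>.  The values of \<open>w\<close>
  outside \<open>E\<close> are irrelevant.
\<close>

definition weighted_digraph :: "('v \<times> 'v) set \<Rightarrow> ('v \<Rightarrow> 'v \<Rightarrow> real) \<Rightarrow> bool" where
  "weighted_digraph E w \<longleftrightarrow> (\<forall>j i. (j, i) \<in> E \<longrightarrow> w j i > 0)"

definition weakly_connected :: "('v \<times> 'v) set \<Rightarrow> bool" where
  "weakly_connected E \<longleftrightarrow> (\<forall>u v. (u, v) \<in> (E \<union> E\<inverse>)\<^sup>*)"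

definition adjacency_matrix ::
  "('v \<times> 'v) set \<Rightarrow> ('v \<Rightarrow> 'v \<Rightarrow> real) \<Rightarrow> real ^ 'v ^ 'v::finite" where
  "adjacency_matrix E w = (\<chi> i j. if (j, i) \<in> E then w j i else 0)"

definition fill_zero_rows :: "real ^ 'v ^ 'v::finite \<Rightarrow> real ^ 'v ^ 'v" where
  "fill_zero_rows Q = (\<chi> i j. if row i Q = 0 \<and> j = i then 1 else Q $ i $ j)"

definition normalize_rows :: "real ^ 'v ^ 'v::finite \<Rightarrow> real ^ 'v ^ 'v" where
  "normalize_rows Q = (\<chi> i j. Q $ i $ j / (\<Sum>k\<in>UNIV. Q $ i $ k))"

definition stochastic_matrix ::
  "('v \<times> 'v) set \<Rightarrow> ('v \<Rightarrow> 'v \<Rightarrow> real) \<Rightarrow> real ^ 'v ^ 'v::finite" where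
  "stochastic_matrix E w = normalize_rows (fill_zero_rows (adjacency_matrix E w))"

definition laplacian :: "real ^ 'v ^ 'v::finite \<Rightarrow> real ^ 'v ^ 'v" where
  "laplacian A = mat 1 - A"

subsection \<open>Reaches, kernels and influence, for a row stochastic matrix \<open>A\<close>\<close>

definition arcs_of :: "real ^ 'v ^ 'v::finite \<Rightarrow> ('v \<times> 'v) set" where
  "arcs_of A = {(j, i). i \<noteq> j \<and> A $ i $ j > 0}"

definition reachable :: "real ^ 'v ^ 'v::finite \<Rightarrow> 'v \<Rightarrow> 'v set" where
  "reachable A j = {i. (j, i) \<in> (arcs_of A)\<^sup>*}"

definition reaches :: "real ^ 'v ^ 'v::finite \<Rightarrow> 'v set set" where
  "reaches A = {R \<in> range (reachable A). \<forall>j. \<not> R \<subset> reachable A j}"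

definition exclusive_part :: "real ^ 'v ^ 'v::finite \<Rightarrow> 'v set \<Rightarrow> 'v set" where
  "exclusive_part A R = R - \<Union>(reaches A - {R})"

definition common_part :: "real ^ 'v ^ 'v::finite \<Rightarrow> 'v set \<Rightarrow> 'v set" where
  "common_part A R = R - exclusive_part A R"

definition cabal :: "real ^ 'v ^ 'v::finite \<Rightarrow> 'v set \<Rightarrow> 'v set" where
  "cabal A R = {r \<in> R. reachable A r = R}"

text \<open>
  The kernel vectors \<open>\<gamma>\<^sub>1, \<dots>, \<gamma>\<^sub>k\<close> are indexed by the reaches themselves instead of by a
  numbering of the reaches.
\<close>

definition is_right_kernel_basis ::
  "real ^ 'v ^ 'v::finite \<Rightarrow> ('v set \<Rightarrow> real ^ 'v) \<Rightarrow> bool" where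
  "is_right_kernel_basis A \<gamma> \<longleftrightarrow>
     inj_on \<gamma> (reaches A) \<and> independent (\<gamma> ` reaches A) \<and>
     span (\<gamma> ` reaches A) = {x. laplacian A *v x = 0} \<and>
     (\<forall>R\<in>reaches A.
        (\<forall>i\<in>exclusive_part A R. \<gamma> R $ i = 1) \<and>
        (\<forall>i\<in>common_part A R. 0 < \<gamma> R $ i \<and> \<gamma> R $ i < 1) \<and>
        (\<forall>i. i \<notin> R \<longrightarrow> \<gamma> R $ i = 0)) \<and>
     (\<Sum>R\<in>reaches A. \<gamma> R) = 1"

definition is_left_kernel_basis ::
  "real ^ 'v ^ 'v::finite \<Rightarrow> ('v set \<Rightarrow> real ^ 'v) \<Rightarrow> bool" where
  "is_left_kernel_basis A \<gamma> \<longleftrightarrow>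
     inj_on \<gamma> (reaches A) \<and> independent (\<gamma> ` reaches A) \<and>
     span (\<gamma> ` reaches A) = {x. x v* laplacian A = 0} \<and>
     (\<forall>R\<in>reaches A.
        (\<forall>i. 0 \<le> \<gamma> R $ i) \<and>
        {i. \<gamma> R $ i \<noteq> 0} = cabal A R \<and>
        (\<Sum>i\<in>UNIV. \<gamma> R $ i) = 1)"

text \<open>
  For row stochastic \<open>A\<close> such bases exist, and their values on \<open>reaches A\<close> are uniquely
  determined by the conditions above, so the choice is immaterial.
\<close>

definition right_kernel_basis :: "real ^ 'v ^ 'v::finite \<Rightarrow> 'v set \<Rightarrow> real ^ 'v" where
  "right_kernel_basis A = (SOME \<gamma>. is_right_kernel_basis A \<gamma>)"

definition left_kernel_basis :: "real ^ 'v ^ 'v::finite \<Rightarrow> 'v set \<Rightarrow> real ^ 'v" where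
  "left_kernel_basis A = (SOME \<gamma>. is_left_kernel_basis A \<gamma>)"

text \<open>
  The product \<open>\<Gamma>\<^sup>0 \<Gamma>'\<^sup>0\<close> of the matrix with columns \<open>\<gamma>\<^sub>i\<close> and the matrix whose rows are the
  left kernel vectors; the inner dimension ranges over the reaches.
\<close>

definition kernel_projection :: "real ^ 'v ^ 'v::finite \<Rightarrow> real ^ 'v ^ 'v" where
  "kernel_projection A =
     (\<chi> u v. \<Sum>R\<in>reaches A. right_kernel_basis A R $ u * left_kernel_basis A R $ v)"

definition influence :: "real ^ 'v ^ 'v::finite \<Rightarrow> 'v \<Rightarrow> real" where
  "influence A v = (1 / real CARD('v)) * (1 \<bullet> (kernel_projection A *v axis v 1))"

subsection \<open>The extended graph and pagerank\<close>

text \<open>In the extended graph \<open>Inl v\<close> is the new vertex \<open>b\<^sub>v\<close> and \<open>Inr v\<close> is the old vertex \<open>v\<close>.\<close>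

definition extended_edges ::
  "('v \<times> 'v) set \<Rightarrow> ('v \<Rightarrow> 'v \<Rightarrow> real) \<Rightarrow> (('v::finite + 'v) \<times> ('v + 'v)) set" where
  "extended_edges E w =
     {(Inr j, Inr i) | j i. stochastic_matrix E w $ i $ j > 0} \<union> {(Inl v, Inr v) | v. True}"

definition extended_weight ::
  "real \<Rightarrow> ('v \<times> 'v) set \<Rightarrow> ('v \<Rightarrow> 'v \<Rightarrow> real) \<Rightarrow> ('v::finite + 'v) \<Rightarrow> ('v + 'v) \<Rightarrow> real" where
  "extended_weight \<alpha> E w x y =
     (case (x, y) of (Inr j, Inr i) \<Rightarrow> stochastic_matrix E w $ i $ j | _ \<Rightarrow> \<alpha>)"

definition extended_stochastic_matrix ::
  "real \<Rightarrow> ('v \<times> 'v) set \<Rightarrow> ('v \<Rightarrow> 'v \<Rightarrow> real) \<Rightarrow> real ^ ('v::finite + 'v) ^ ('v + 'v)" where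
  "extended_stochastic_matrix \<alpha> E w =
     stochastic_matrix (extended_edges E w) (extended_weight \<alpha> E w)"

definition pagerank ::
  "real \<Rightarrow> ('v \<times> 'v) set \<Rightarrow> ('v \<Rightarrow> 'v \<Rightarrow> real) \<Rightarrow> real ^ 'v::finite" where
  "pagerank \<alpha> E w =
     (\<chi> v. 2 * influence (extended_stochastic_matrix \<alpha> E w) (Inl v) - 1 / real CARD('v))"

definition probability_vector :: "real ^ 'v::finite \<Rightarrow> bool" where
  "probability_vector p \<longleftrightarrow> (\<forall>v. 0 \<le> p $ v) \<and> (\<Sum>v\<in>UNIV. p $ v) = 1"

definition all_ones_matrix :: "real ^ 'v ^ 'v::finite" where
  "all_ones_matrix = (\<chi> i j. 1)"

subsection \<open>Block form of the extended stochastic matrix\<close>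

lemma fill_zero_rows_adjacency:
  assumes "weighted_digraph E w"
  shows fill_zero_rows_adjacency_nonneg: "0 \<le> fill_zero_rows (adjacency_matrix E w) $ i $ j"
    and fill_zero_rows_adjacency_sum_pos:
      "0 < (\<Sum>k\<in>UNIV. fill_zero_rows (adjacency_matrix E w) $ i $ k)"
proof -
  let ?Q = "adjacency_matrix E w"
  have Q: "0 \<le> ?Q $ a $ b" for a b
    using assms by (auto simp: adjacency_matrix_def weighted_digraph_def less_imp_le)
  have nn: "0 \<le> fill_zero_rows ?Q $ a $ b" for a b
    using Q by (simp add: fill_zero_rows_def)
  then show "0 \<le> fill_zero_rows ?Q $ i $ j" .
  have "\<exists>k. 0 < fill_zero_rows ?Q $ i $ k"
  proof (cases "row i ?Q = 0")
    case True
    then show ?thesis by (intro exI[of _ i]) (simp add: fill_zero_rows_def)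
  next
    case False
    then obtain k where "?Q $ i $ k \<noteq> 0"
      by (auto simp: row_def vec_eq_iff)
    then have "0 < ?Q $ i $ k" using Q[of i k] by simp
    with False show ?thesis by (intro exI[of _ k]) (simp add: fill_zero_rows_def)
  qed
  then show "0 < (\<Sum>k\<in>UNIV. fill_zero_rows ?Q $ i $ k)"
    using nn by (meson UNIV_I finite sum_pos2)
qed

lemma stochastic_matrix_nonneg:
  "weighted_digraph E w \<Longrightarrow> 0 \<le> stochastic_matrix E w $ i $ j"
  using fill_zero_rows_adjacency_nonneg[of E w i j] fill_zero_rows_adjacency_sum_pos[of E w i]
  by (simp add: stochastic_matrix_def normalize_rows_def)

lemma stochastic_matrix_row_sum:
  "weighted_digraph E w \<Longrightarrow> (\<Sum>j\<in>UNIV. stochastic_matrix E w $ i $ j) = 1"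
  using fill_zero_rows_adjacency_sum_pos[of E w i]
  by (simp add: stochastic_matrix_def normalize_rows_def flip: sum_divide_distrib)

lemma extended_stochastic_matrix_block:
  fixes E :: "('v::finite \<times> 'v) set"
  assumes "weighted_digraph E w" "\<alpha> > 0"
  shows "extended_stochastic_matrix \<alpha> E w $ x $ y =
    (case (x, y) of
       (Inl u, Inl v) \<Rightarrow> (if u = v then 1 else 0)
     | (Inl u, Inr v) \<Rightarrow> 0
     | (Inr u, Inl v) \<Rightarrow> (if u = v then \<alpha> / (1 + \<alpha>) else 0)
     | (Inr u, Inr v) \<Rightarrow> (1 / (1 + \<alpha>)) * stochastic_matrix E w $ u $ v)"
proof -
  let ?S = "stochastic_matrix E w"
  define Q where "Q = adjacency_matrix (extended_edges E w) (extended_weight \<alpha> E w)"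
  have Sz: "?S $ i $ j = 0" if "\<not> ?S $ i $ j > 0" for i j
    using that stochastic_matrix_nonneg[OF assms(1), of i j] by simp
  have Q: "Q $ Inl u $ y = 0" "Q $ Inr u $ Inl v = (if u = v then \<alpha> else 0)"
    "Q $ Inr u $ Inr v = ?S $ u $ v" for u v y
    by (auto simp: Q_def adjacency_matrix_def extended_edges_def extended_weight_def Sz)
  have rl: "row (Inl u) Q = 0" for u
    by (simp add: row_def vec_eq_iff Q)
  have rr: "row (Inr u) Q \<noteq> 0" for u
  proof
    assume "row (Inr u) Q = 0"
    then have "row (Inr u) Q $ Inl u = 0" by simp
    then show False using assms(2) by (simp add: row_def Q)
  qed
  define F where "F = fill_zero_rows Q"
  have F: "F $ Inl u $ y = (if y = Inl u then 1 else 0)"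
    "F $ Inr u $ Inl v = (if u = v then \<alpha> else 0)" "F $ Inr u $ Inr v = ?S $ u $ v" for u v y
    by (auto simp: F_def fill_zero_rows_def rl rr Q)
  have sl: "(\<Sum>k\<in>UNIV. F $ Inl u $ k) = 1" for u
    by (simp add: F)
  have sr: "(\<Sum>k\<in>UNIV. F $ Inr u $ k) = 1 + \<alpha>" for u
  proof -
    have "(\<Sum>k\<in>UNIV. F $ Inr u $ k) =
        (\<Sum>k\<in>range Inl. F $ Inr u $ k) + (\<Sum>k\<in>range Inr. F $ Inr u $ k)"
      unfolding UNIV_sum by (rule sum.union_disjoint) auto
    also have "\<dots> = (\<Sum>v\<in>UNIV. F $ Inr u $ Inl v) + (\<Sum>v\<in>UNIV. F $ Inr u $ Inr v)"
      by (simp add: sum.reindex)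
    also have "\<dots> = 1 + \<alpha>"
      by (simp add: F stochastic_matrix_row_sum[OF assms(1)])
    finally show ?thesis .
  qed
  have "extended_stochastic_matrix \<alpha> E w = normalize_rows F"
    by (simp add: extended_stochastic_matrix_def stochastic_matrix_def[of "extended_edges E w"]
        F_def Q_def)
  then show ?thesis
    by (cases x; cases y) (auto simp: normalize_rows_def sl sr F)
qed

end

theory Submission imports Defs begin

text \<open>
  In the extended graph the new vertices \<open>b\<^sub>v\<close> are absorbing: a walker that follows the rows of the
  extended matrix stops at \<open>b\<^sub>u\<close> with probability \<open>1 - \<beta>\<close> when standing at \<open>u\<close>, and otherwise makes a
  step of \<open>S\<close>.  Let \<open>Z = (1 - \<beta>) (I - \<beta> S)\<^sup>-\<^sup>1\<close>; its entry \<open>Z\<^sub>u\<^sub>v\<close> is the probability that a walker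
  starting at \<open>u\<close> is absorbed at \<open>b\<^sub>v\<close>.  A vector is harmonic for the extended matrix iff its old part
  is \<open>Z\<close> times its new part, so harmonic vectors are determined by their values on the new vertices,
  and the kernel vector of the reach of \<open>b\<^sub>v\<close>, being \<open>1\<close> at \<open>b\<^sub>v\<close> and \<open>0\<close> at the other new vertices,
  must be column \<open>v\<close> of \<open>Z\<close> below a unit vector.  The cabal of this reach is \<open>{b\<^sub>v}\<close>, so the left
  kernel vector is the unit vector at \<open>b\<^sub>v\<close>.  Hence the influence of \<open>b\<^sub>v\<close> is
  \<open>(1 + \<Sum>\<^sub>u Z\<^sub>u\<^sub>v) / 2n\<close>, that is, pagerank is the row vector \<open>(1/n) 1\<^sup>T Z\<close>
  (lemma \<open>influence_new_vertex\<close>).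

  Everything asserted about pagerank then follows from the properties of \<open>Z\<close>.  It is a probability
  vector because \<open>Z\<close> is row stochastic, and since \<open>Z\<close> is a multiple of the inverse of
  \<open>I - \<beta> S\<close>, it is the only solution of \<open>p (I - \<beta> S) = ((1 - \<beta>)/n) 1\<^sup>T\<close>, which is the pagerank
  equation.

  Because the kernel bases are given by a choice operator, it has to be shown that bases with the
  prescribed properties exist for the extended matrix.  The signs and supports that this requires
  come from a maximum principle for \<open>\<beta> S\<close> (lemma \<open>maximum_principle\<close>), which also yields the
  invertibility of \<open>I - \<beta> S\<close>.
\<close>

section \<open>Damped stochastic matrices and their resolvent\<close>

lemma sum_UNIV_Plus:
  fixes f :: "'a::finite + 'b::finite \<Rightarrow> 'c::comm_monoid_add"
  shows "sum f UNIV = (\<Sum>a\<in>UNIV. f (Inl a)) + (\<Sum>b\<in>UNIV. f (Inr b))"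
  by (simp add: sum.Plus flip: UNIV_Plus_UNIV)

locale damped_stochastic =
  fixes S :: "real ^ 'v ^ 'v::finite" and \<beta> :: real
  assumes S_nonneg: "0 \<le> S $ i $ j"
    and S_row_sum: "(\<Sum>j\<in>UNIV. S $ i $ j) = 1"
    and \<beta>_pos: "0 < \<beta>" and \<beta>_less_1: "\<beta> < 1"
begin

text \<open>
  At a point of \<open>U\<close> where \<open>y\<close> is largest on \<open>U\<close>, averaging with \<open>S\<close> cannot increase \<open>y\<close>, so the
  maximum is at most \<open>\<beta>\<close> times itself.  With a proper subset \<open>U\<close> this controls vectors at vertices
  that cannot be reached from a given new vertex.
\<close>

lemma maximum_principle:
  assumes sub: "\<And>i. i \<in> U \<Longrightarrow> y i \<le> \<beta> * (\<Sum>k\<in>UNIV. S $ i $ k * y k)"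
    and closed: "\<And>i k. \<lbrakk>i \<in> U; 0 < S $ i $ k\<rbrakk> \<Longrightarrow> k \<in> U"
    and "i \<in> U"
  shows "y i \<le> 0"
proof -
  have "finite (y ` U)" "y ` U \<noteq> {}" using \<open>i \<in> U\<close> by auto
  then have "Max (y ` U) \<in> y ` U" by (rule Max_in)
  then obtain m where "m \<in> U" "Max (y ` U) = y m" by auto
  then have m: "m \<in> U" "\<And>k. k \<in> U \<Longrightarrow> y k \<le> y m"
    using Max_ge[OF \<open>finite (y ` U)\<close>] by (auto simp flip: \<open>Max (y ` U) = y m\<close>)
  have "S $ m $ k * y k \<le> S $ m $ k * y m" for k
  proof (cases "S $ m $ k = 0")
    case False
    then have "0 < S $ m $ k" using S_nonneg[of m k] by simp
    then show ?thesis using m closed by (simp add: mult_left_mono)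
  qed simp
  then have "(\<Sum>k\<in>UNIV. S $ m $ k * y k) \<le> (\<Sum>k\<in>UNIV. S $ m $ k * y m)"
    by (simp add: sum_mono)
  also have "\<dots> = y m" by (simp add: S_row_sum flip: sum_distrib_right)
  finally have "y m \<le> \<beta> * y m"
    using sub[OF m(1)] \<beta>_pos by (meson less_imp_le mult_left_mono order_trans)
  then have "(1 - \<beta>) * y m \<le> 0" by (simp add: algebra_simps)
  then have "y m \<le> 0" using \<beta>_less_1 by (simp add: mult_le_0_iff)
  then show ?thesis using m(2)[OF \<open>i \<in> U\<close>] by simp
qed

definition damped_laplacian :: "real ^ 'v ^ 'v" where
  "damped_laplacian = mat 1 - \<beta> *\<^sub>R S"

lemma damped_laplacian_mult:
  "(damped_laplacian *v x) $ i = x $ i - \<beta> * (\<Sum>k\<in>UNIV. S $ i $ k * x $ k)"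
  by (simp add: damped_laplacian_def matrix_vector_mult_diff_rdistrib
      scaleR_matrix_vector_assoc[symmetric] matrix_vector_mult_def[of S])

lemma damped_laplacian_vec_mult:
  "p v* damped_laplacian = p - \<beta> *\<^sub>R (p v* S)"
  by (simp add: vec_eq_iff damped_laplacian_def vector_matrix_mult_def mat_def
      algebra_simps sum_subtractf sum_distrib_left if_distrib[of "(*) _"] cong: if_cong)

lemma invertible_damped_laplacian: "invertible damped_laplacian"
  unfolding invertible_left_inverse matrix_left_invertible_ker
proof (intro allI impI)
  fix x assume "damped_laplacian *v x = 0"
  then have x: "x $ i = \<beta> * (\<Sum>k\<in>UNIV. S $ i $ k * x $ k)" for i
    using damped_laplacian_mult[of x i] by simp
  have "x $ i \<le> 0" for i
    by (rule maximum_principle[of UNIV, OF eq_refl[OF x]]) simp_all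
  moreover have "- x $ i \<le> 0" for i
  proof (rule maximum_principle[of UNIV "\<lambda>i. - x $ i"])
    show "- x $ i \<le> \<beta> * (\<Sum>k\<in>UNIV. S $ i $ k * - x $ k)" for i
      by (subst x) (simp add: sum_negf)
  qed simp_all
  ultimately show "x = 0" by (simp add: vec_eq_iff order_antisym)
qed

text \<open>
  This is the matrix \<open>Z\<close>: entry \<open>(u, v)\<close> is the probability that the walk of \<open>S\<close> from \<open>u\<close>, which is
  stopped before each step with probability \<open>1 - \<beta>\<close>, stops at \<open>v\<close>.
\<close>

definition absorption :: "real ^ 'v ^ 'v" where
  "absorption = (1 - \<beta>) *\<^sub>R matrix_inv damped_laplacian"

lemma damped_laplacian_absorption: "damped_laplacian ** absorption = (1 - \<beta>) *\<^sub>R mat 1"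
  and absorption_damped_laplacian: "absorption ** damped_laplacian = (1 - \<beta>) *\<^sub>R mat 1"
proof -
  have "damped_laplacian ** matrix_inv damped_laplacian = mat 1 \<and>
      matrix_inv damped_laplacian ** damped_laplacian = mat 1"
    using invertible_damped_laplacian unfolding invertible_def matrix_inv_def by (rule someI_ex)
  then show "damped_laplacian ** absorption = (1 - \<beta>) *\<^sub>R mat 1"
    "absorption ** damped_laplacian = (1 - \<beta>) *\<^sub>R mat 1"
    by (simp_all add: absorption_def matrix_scalar_ac flip: scalar_matrix_assoc)
qed

lemma absorption_unique:
  assumes "\<And>i. y $ i = \<beta> * (\<Sum>k\<in>UNIV. S $ i $ k * y $ k) + (1 - \<beta>) * c $ i"
  shows "y = absorption *v c"
proof -
  have "damped_laplacian *v y = (1 - \<beta>) *\<^sub>R c"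
  proof (subst vec_eq_iff, intro allI)
    fix i
    show "(damped_laplacian *v y) $ i = ((1 - \<beta>) *\<^sub>R c) $ i"
      using assms[of i] by (simp add: damped_laplacian_mult)
  qed
  then have "absorption *v (damped_laplacian *v y) = (1 - \<beta>) *\<^sub>R (absorption *v c)"
    by (simp add: matrix_vector_mult_scaleR)
  then have "(1 - \<beta>) *\<^sub>R y = (1 - \<beta>) *\<^sub>R (absorption *v c)"
    by (simp add: matrix_vector_mul_assoc absorption_damped_laplacian
        scaleR_matrix_vector_assoc[symmetric])
  then show ?thesis using \<beta>_less_1 by simp
qed

text \<open>First-step analysis: stop immediately, or make one step of \<open>S\<close>.\<close>

lemma absorption_step:
  "absorption $ i $ v = \<beta> * (\<Sum>k\<in>UNIV. S $ i $ k * absorption $ k $ v)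
     + (1 - \<beta>) * (if i = v then 1 else 0)"
proof -
  have "(damped_laplacian *v column v absorption) $ i = ((1 - \<beta>) *\<^sub>R mat 1 :: real^'v^'v) $ i $ v"
    by (simp add: matrix_vector_mult_def matrix_matrix_mult_def column_def
        flip: damped_laplacian_absorption)
  then show ?thesis
    by (simp add: damped_laplacian_mult column_def mat_def algebra_simps)
qed

text \<open>
  By first-step analysis the columns are supersolutions, so their negatives obey the maximum principle.
\<close>

lemma absorption_nonneg: "0 \<le> absorption $ i $ v"
proof -
  have "- absorption $ i $ v \<le> 0"
  proof (rule maximum_principle[of UNIV "\<lambda>i. - absorption $ i $ v"])
    show "- absorption $ i $ v \<le> \<beta> * (\<Sum>k\<in>UNIV. S $ i $ k * - absorption $ k $ v)" for i
      using absorption_step[of i v] \<beta>_less_1 by (simp add: sum_negf split: if_splits)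
  qed auto
  then show ?thesis by simp
qed

lemma absorption_row_sum: "(\<Sum>v\<in>UNIV. absorption $ u $ v) = 1"
proof -
  have "(1 :: real^'v) = absorption *v 1"
    by (rule absorption_unique) (simp add: S_row_sum)
  then have "(1 :: real^'v) $ u = (absorption *v 1) $ u" by simp
  then show ?thesis by (simp add: matrix_vector_mult_def)
qed

section \<open>Harmonic vectors and reaches of the extended matrix\<close>

text \<open>
  Since \<open>\<beta> = 1 / (1 + \<alpha>)\<close>, the entry \<open>\<alpha> / (1 + \<alpha>)\<close> of the block form is \<open>1 - \<beta>\<close>.  As in the extended
  graph, \<open>Inl v\<close> stands for \<open>b\<^sub>v\<close>.
\<close>

definition extension :: "real ^ ('v + 'v) ^ ('v + 'v)" where
  "extension = (\<chi> x y. case (x, y) of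
       (Inl u, Inl v) \<Rightarrow> (if u = v then 1 else 0)
     | (Inl u, Inr v) \<Rightarrow> 0
     | (Inr u, Inl v) \<Rightarrow> (if u = v then 1 - \<beta> else 0)
     | (Inr u, Inr v) \<Rightarrow> \<beta> * S $ u $ v)"

lemma extension_simps [simp]:
  "extension $ Inl u $ Inl v = (if u = v then 1 else 0)"
  "extension $ Inl u $ Inr v = 0"
  "extension $ Inr u $ Inl v = (if u = v then 1 - \<beta> else 0)"
  "extension $ Inr u $ Inr v = \<beta> * S $ u $ v"
  by (simp_all add: extension_def)

lemma extension_nonneg: "0 \<le> extension $ x $ y"
  using \<beta>_pos \<beta>_less_1 S_nonneg by (cases x; cases y) auto

lemma right_kernel_iff:
  "laplacian extension *v x = 0 \<longleftrightarrow>
     (\<forall>i. x $ Inr i = \<beta> * (\<Sum>k\<in>UNIV. S $ i $ k * x $ Inr k) + (1 - \<beta>) * x $ Inl i)"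
proof -
  have "laplacian extension *v x = 0 \<longleftrightarrow> (\<forall>z. x $ z = (extension *v x) $ z)"
    by (simp add: laplacian_def matrix_vector_mult_diff_rdistrib vec_eq_iff)
  moreover have "(extension *v x) $ Inl u = x $ Inl u" for u
    by (simp add: matrix_vector_mult_def sum_UNIV_Plus if_distrib[of "\<lambda>a. a * _"] cong: if_cong)
  moreover have "(extension *v x) $ Inr i =
      \<beta> * (\<Sum>k\<in>UNIV. S $ i $ k * x $ Inr k) + (1 - \<beta>) * x $ Inl i" for i
    by (simp add: matrix_vector_mult_def sum_UNIV_Plus sum_distrib_left mult.assoc
        if_distrib[of "\<lambda>a. a * _"] cong: if_cong)
  ultimately show ?thesis
    by (metis (no_types, lifting) sum.exhaust)
qed

text \<open>
  Already the columns of the new vertices force a left kernel vector to vanish on the old vertices: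
  every old vertex leaks mass into its new vertex, which never leaves it again.
\<close>

lemma left_kernel_iff:
  "x v* laplacian extension = 0 \<longleftrightarrow> (\<forall>i. x $ Inr i = 0)"
proof -
  have "x v* laplacian extension = 0 \<longleftrightarrow> (\<forall>z. x $ z = (\<Sum>y\<in>UNIV. extension $ y $ z * x $ y))"
    by (simp add: vec_eq_iff laplacian_def vector_matrix_mult_def mat_def
        algebra_simps sum_subtractf if_distrib[of "(*) _"] cong: if_cong)
  moreover have "(\<Sum>y\<in>UNIV. extension $ y $ Inl u * x $ y) = x $ Inl u + (1 - \<beta>) * x $ Inr u" for u
    by (simp add: sum_UNIV_Plus if_distrib[of "\<lambda>a. a * _"] cong: if_cong)
  moreover have "(\<Sum>y\<in>UNIV. extension $ y $ Inr j * x $ y)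
      = (\<Sum>k\<in>UNIV. \<beta> * S $ k $ j * x $ Inr k)" for j
    by (simp add: sum_UNIV_Plus)
  ultimately have *: "x v* laplacian extension = 0 \<longleftrightarrow>
      (\<forall>u. (1 - \<beta>) * x $ Inr u = 0) \<and> (\<forall>j. x $ Inr j = (\<Sum>k\<in>UNIV. \<beta> * S $ k $ j * x $ Inr k))"
    by (simp add: split_sum_all)
  show ?thesis unfolding * using \<beta>_less_1 by auto
qed

definition reach :: "'v \<Rightarrow> ('v + 'v) set" where
  "reach v = reachable extension (Inl v)"

lemma arcs_extension_simps:
  "(x, Inl v) \<notin> arcs_of extension"
  "(Inl u, Inr v) \<in> arcs_of extension \<longleftrightarrow> u = v"
  "(Inr u, Inr v) \<in> arcs_of extension \<longleftrightarrow> u \<noteq> v \<and> 0 < S $ v $ u"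
  using \<beta>_pos \<beta>_less_1 by (cases x; auto simp: arcs_of_def zero_less_mult_iff)+

lemma new_vertex_reachable_iff: "Inl u \<in> reachable extension x \<longleftrightarrow> x = Inl u"
  unfolding reachable_def
  by (auto elim: rtranclE simp: arcs_extension_simps)

lemma new_vertex_in_reach_iff [simp]: "Inl u \<in> reach v \<longleftrightarrow> u = v"
  by (auto simp: reach_def new_vertex_reachable_iff)

lemma inj_reach: "inj reach"
  by (metis injI new_vertex_in_reach_iff)

lemma old_vertex_in_reach [simp]: "Inr v \<in> reach v"
  by (auto simp: reach_def reachable_def arcs_extension_simps)

lemma old_reachable_psubset: "reachable extension (Inr v) \<subset> reach v"
proof -
  have "(Inl v, Inr v) \<in> (arcs_of extension)\<^sup>*" by (auto simp: arcs_extension_simps)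
  then have "reachable extension (Inr v) \<subseteq> reach v"
    by (auto simp: reach_def reachable_def intro: rtrancl_trans)
  moreover have "Inl v \<in> reach v" "Inl v \<notin> reachable extension (Inr v)"
    by (simp_all add: new_vertex_reachable_iff)
  ultimately show ?thesis by blast
qed

lemma reaches_extension: "reaches extension = range reach"
proof
  show "reaches extension \<subseteq> range reach"
  proof
    fix R assume R: "R \<in> reaches extension"
    then obtain x where x: "R = reachable extension x" and max: "\<And>j. \<not> R \<subset> reachable extension j"
      by (auto simp: reaches_def)
    show "R \<in> range reach"
    proof (cases x)
      case (Inl v)
      then show ?thesis using x by (simp add: reach_def)
    next
      case (Inr v)
      then show ?thesis using x max old_reachable_psubset by (auto simp: reach_def)
    qed
  qed
next
  have "\<not> reach v \<subset> reachable extension x" for v x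
  proof
    assume *: "reach v \<subset> reachable extension x"
    then have "Inl v \<in> reachable extension x" by (meson new_vertex_in_reach_iff psubsetD)
    then show False using * by (simp add: new_vertex_reachable_iff reach_def)
  qed
  then show "range reach \<subseteq> reaches extension"
    by (auto simp: reaches_def reach_def)
qed

lemma cabal_reach: "cabal extension (reach v) = {Inl v}"
proof -
  have "x = Inl v" if "reachable extension x = reach v" for x
    using that new_vertex_reachable_iff[of v x] by simp
  then show ?thesis by (auto simp: cabal_def reach_def new_vertex_reachable_iff)
qed

lemma new_vertex_exclusive: "Inl v \<in> exclusive_part extension (reach v)"
  by (auto simp: exclusive_part_def reaches_extension)

section \<open>The kernel bases of the extended matrix\<close>

definition harmonic_measure :: "'v \<Rightarrow> real ^ ('v + 'v)" where
  "harmonic_measure v =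
     (\<chi> x. case x of Inl u \<Rightarrow> (if u = v then 1 else 0) | Inr u \<Rightarrow> absorption $ u $ v)"

lemma harmonic_measure_simps [simp]:
  "harmonic_measure v $ Inl u = (if u = v then 1 else 0)"
  "harmonic_measure v $ Inr u = absorption $ u $ v"
  by (simp_all add: harmonic_measure_def)

lemma harmonic_measure_kernel: "laplacian extension *v harmonic_measure v = 0"
  unfolding right_kernel_iff harmonic_measure_simps by (intro allI absorption_step)

lemma harmonic_measure_nonneg: "0 \<le> harmonic_measure v $ x"
  by (cases x) (auto simp: absorption_nonneg)

lemma harmonic_measure_sum: "(\<Sum>v\<in>UNIV. harmonic_measure v) = 1"
  by (simp add: vec_eq_iff split_sum_all absorption_row_sum)

lemma right_kernel_expansion:
  assumes "laplacian extension *v x = 0"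
  shows "x = (\<Sum>v\<in>UNIV. x $ Inl v *\<^sub>R harmonic_measure v)"
proof -
  have "(\<chi> i. x $ Inr i) = absorption *v (\<chi> i. x $ Inl i)"
    by (rule absorption_unique, unfold vec_lambda_beta)
      (rule assms[unfolded right_kernel_iff, rule_format])
  then have "x $ Inr i = (\<Sum>v\<in>UNIV. absorption $ i $ v * x $ Inl v)" for i
    by (simp add: vec_eq_iff matrix_vector_mult_def)
  then show ?thesis
    by (simp add: vec_eq_iff split_sum_all if_distrib[of "(*) _"] mult.commute cong: if_cong)
qed

text \<open>
  Positivity propagates along arcs: the value at the head is an average of nonnegative values in which
  the value at the tail has positive weight.
\<close>

lemma harmonic_measure_pos:
  assumes "x \<in> reach v" shows "0 < harmonic_measure v $ x"
proof -
  have "(Inl v, x) \<in> (arcs_of extension)\<^sup>*" using assms by (simp add: reach_def reachable_def)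
  then show ?thesis
  proof induction
    case (step y z)
    have "0 < extension $ z $ y * harmonic_measure v $ y"
      using step by (auto simp: arcs_of_def)
    also have "\<dots> \<le> (\<Sum>y\<in>UNIV. extension $ z $ y * harmonic_measure v $ y)"
      by (rule member_le_sum) (auto simp: extension_nonneg harmonic_measure_nonneg)
    also have "\<dots> = harmonic_measure v $ z"
      using arg_cong[OF harmonic_measure_kernel[of v], of "\<lambda>y. y $ z"]
      by (simp add: laplacian_def matrix_vector_mult_diff_rdistrib
          matrix_vector_mult_def[of extension])
    finally show ?case .
  qed simp
qed

text \<open>
  Arcs run from \<open>k\<close> to \<open>i\<close> when \<open>S\<^sub>i\<^sub>k > 0\<close>, whereas the walk steps from \<open>i\<close> to \<open>k\<close>.  So a walk that
  starts outside the reach of \<open>b\<^sub>v\<close> stays outside, and the maximum principle applies there.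
\<close>

lemma harmonic_measure_eq_0:
  assumes "x \<notin> reach v" shows "harmonic_measure v $ x = 0"
proof (cases x)
  case (Inl u)
  then show ?thesis using assms by auto
next
  case (Inr u)
  have "absorption $ u $ v \<le> 0"
  proof (rule maximum_principle[of "{i. Inr i \<notin> reach v}" "\<lambda>i. absorption $ i $ v"])
    fix i assume "i \<in> {i. Inr i \<notin> reach v}"
    then have "i \<noteq> v" by auto
    then show "absorption $ i $ v \<le> \<beta> * (\<Sum>k\<in>UNIV. S $ i $ k * absorption $ k $ v)"
      using absorption_step[of i v] by simp
  next
    fix i k assume i: "i \<in> {i. Inr i \<notin> reach v}" and "0 < S $ i $ k"
    then have "i = k \<or> (Inr k, Inr i) \<in> arcs_of extension" by (auto simp: arcs_extension_simps)
    then show "k \<in> {i. Inr i \<notin> reach v}"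
      using i by (auto simp: reach_def reachable_def intro: rtrancl_into_rtrancl)
  qed (use assms Inr in auto)
  then show ?thesis using absorption_nonneg[of u v] Inr by simp
qed

text \<open>
  The measures of all new vertices sum to \<open>1\<close> at \<open>x\<close>.  If \<open>x\<close> lies in no other reach, only one summand
  survives; if it does, another summand is positive.  This settles the exclusive and the common part.
\<close>

lemma harmonic_measure_exclusive:
  assumes "x \<in> exclusive_part extension (reach v)"
  shows "harmonic_measure v $ x = 1"
proof -
  have "harmonic_measure u $ x = 0" if "u \<noteq> v" for u
    using assms that injD[OF inj_reach]
    by (intro harmonic_measure_eq_0) (auto simp: exclusive_part_def reaches_extension)
  then have "(\<Sum>u\<in>UNIV. harmonic_measure u $ x) = (\<Sum>u\<in>{v}. harmonic_measure u $ x)"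
    by (intro sum.mono_neutral_right) auto
  then show ?thesis
    using arg_cong[OF harmonic_measure_sum, of "\<lambda>y. y $ x"] by simp
qed

lemma harmonic_measure_common:
  assumes "x \<in> common_part extension (reach v)"
  shows "harmonic_measure v $ x < 1"
proof -
  obtain u where u: "x \<in> reach u" "reach u \<noteq> reach v"
    using assms by (auto simp: common_part_def exclusive_part_def reaches_extension)
  have "(\<Sum>i\<in>{u, v}. harmonic_measure i $ x) \<le> (\<Sum>i\<in>UNIV. harmonic_measure i $ x)"
    by (rule sum_mono2) (auto simp: harmonic_measure_nonneg)
  also have "\<dots> = 1"
    using arg_cong[OF harmonic_measure_sum, of "\<lambda>y. y $ x"] by simp
  finally have "harmonic_measure u $ x + harmonic_measure v $ x \<le> 1"
    using u by (cases "u = v") auto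
  then show ?thesis using harmonic_measure_pos[OF u(1)] by simp
qed

text \<open>
  Both bases are dual to the new vertices: the vector of the reach of \<open>b\<^sub>v\<close> takes the value \<open>1\<close> at \<open>b\<^sub>v\<close>
  and \<open>0\<close> at the other new vertices, which is all that independence needs.
\<close>

lemma independent_if_dual:
  fixes g :: "'v \<Rightarrow> real ^ ('v + 'v)"
  assumes "\<And>u v. g v $ Inl u = (if u = v then 1 else 0)"
  shows "inj g" "independent (range g)"
proof -
  show inj: "inj g"
    by (rule injI) (metis assms zero_neq_one)
  show "independent (range g)"
  proof (rule independent_if_scalars_zero)
    fix f x assume sum: "(\<Sum>x\<in>range g. f x *\<^sub>R x) = 0" and "x \<in> range g"
    then obtain v where v: "x = g v" by auto
    have "0 = (\<Sum>u\<in>UNIV. f (g u) *\<^sub>R g u) $ Inl v"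
      using sum by (simp add: sum.reindex[OF inj])
    also have "\<dots> = f (g v)" by (simp add: assms if_distrib[of "(*) _"] cong: if_cong)
    finally show "f x = 0" using v by simp
  qed simp
qed

lemma reach_family:
  fixes g :: "'v \<Rightarrow> 'b"
  shows "\<exists>\<gamma>. \<forall>v. \<gamma> (reach v) = g v"
  by (rule exI[of _ "g \<circ> inv reach"]) (simp add: inj_reach)

lemma right_kernel_basis_exists: "\<exists>\<gamma>. is_right_kernel_basis extension \<gamma>"
proof -
  obtain \<gamma> where \<gamma>: "\<And>v. \<gamma> (reach v) = harmonic_measure v"
    using reach_family[of harmonic_measure] by blast
  have img: "\<gamma> ` reaches extension = range harmonic_measure"
    by (simp add: reaches_extension image_image \<gamma>)
  have dual: "inj harmonic_measure" "independent (range harmonic_measure)"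
    by (rule independent_if_dual; simp)+
  have "span (range harmonic_measure) = {x. laplacian extension *v x = 0}"
  proof
    have "subspace {x. laplacian extension *v x = 0}"
      by (auto simp: subspace_def matrix_vector_right_distrib matrix_vector_mult_scaleR)
    then show "span (range harmonic_measure) \<subseteq> {x. laplacian extension *v x = 0}"
      by (intro span_minimal) (auto simp: harmonic_measure_kernel)
    show "{x. laplacian extension *v x = 0} \<subseteq> span (range harmonic_measure)"
    proof
      fix x assume "x \<in> {x. laplacian extension *v x = 0}"
      then have "x = (\<Sum>v\<in>UNIV. x $ Inl v *\<^sub>R harmonic_measure v)"
        using right_kernel_expansion by simp
      also have "\<dots> \<in> span (range harmonic_measure)"
        by (intro span_sum span_scale span_base) simp
      finally show "x \<in> span (range harmonic_measure)" .
    qed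
  qed
  moreover have "inj_on \<gamma> (reaches extension)"
    using dual(1) by (auto simp: reaches_extension inj_on_def \<gamma>)
  moreover have "(\<Sum>R\<in>reaches extension. \<gamma> R) = 1"
    by (simp add: reaches_extension sum.reindex[OF inj_reach] \<gamma> harmonic_measure_sum)
  moreover have "0 < harmonic_measure v $ x" if "x \<in> common_part extension (reach v)" for v x
    using that harmonic_measure_pos by (simp add: common_part_def)
  ultimately have "is_right_kernel_basis extension \<gamma>"
    unfolding is_right_kernel_basis_def img using dual(2)
    by (simp add: reaches_extension \<gamma> harmonic_measure_exclusive harmonic_measure_common
        harmonic_measure_eq_0)
  then show ?thesis by blast
qed

lemma left_kernel_basis_exists: "\<exists>\<gamma>. is_left_kernel_basis extension \<gamma>"
proof -
  define g :: "'v \<Rightarrow> real ^ ('v + 'v)" where "g v = axis (Inl v) 1" for v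
  obtain \<gamma> where \<gamma>: "\<And>v. \<gamma> (reach v) = g v" using reach_family[of g] by blast
  have img: "\<gamma> ` reaches extension = range g"
    by (simp add: reaches_extension image_image \<gamma>)
  have g: "g v $ Inl u = (if u = v then 1 else 0)" "g v $ Inr u = 0" for u v
    by (auto simp: g_def axis_def)
  have dual: "inj g" "independent (range g)"
    by (rule independent_if_dual; simp add: g)+
  have "span (range g) = {x. x v* laplacian extension = 0}"
  proof
    have "subspace {x :: real ^ ('v + 'v). x v* laplacian extension = 0}"
      by (auto simp: subspace_def left_kernel_iff)
    then show "span (range g) \<subseteq> {x. x v* laplacian extension = 0}"
      by (intro span_minimal) (auto simp: left_kernel_iff g)
    show "{x. x v* laplacian extension = 0} \<subseteq> span (range g)"
    proof
      fix x :: "real ^ ('v + 'v)" assume "x \<in> {x. x v* laplacian extension = 0}"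
      then have "\<forall>i. x $ Inr i = 0" by (simp add: left_kernel_iff)
      then have "x = (\<Sum>v\<in>UNIV. x $ Inl v *\<^sub>R g v)"
        by (simp add: vec_eq_iff split_sum_all g if_distrib[of "(*) _"] cong: if_cong)
      also have "\<dots> \<in> span (range g)"
        by (intro span_sum span_scale span_base) simp
      finally show "x \<in> span (range g)" .
    qed
  qed
  moreover have "inj_on \<gamma> (reaches extension)"
    using dual(1) by (auto simp: reaches_extension inj_on_def \<gamma>)
  moreover have "{i. g v $ i \<noteq> 0} = {Inl v}" "0 \<le> g v $ i" "(\<Sum>i\<in>UNIV. g v $ i) = 1" for v i
    by (auto simp: g_def axis_def)
  ultimately have "is_left_kernel_basis extension \<gamma>"
    unfolding is_left_kernel_basis_def img using dual(2)
    by (simp add: reaches_extension \<gamma> cabal_reach)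
  then show ?thesis by blast
qed

text \<open>
  A harmonic vector is determined by its values on the new vertices, and these are prescribed:
  \<open>b\<^sub>v\<close> lies in the exclusive part of its reach, and no other new vertex lies in this reach.
\<close>

lemma right_kernel_basis_reach: "right_kernel_basis extension (reach v) = harmonic_measure v"
proof -
  let ?\<gamma> = "right_kernel_basis extension"
  have basis: "is_right_kernel_basis extension ?\<gamma>"
    unfolding right_kernel_basis_def using right_kernel_basis_exists by (rule someI_ex)
  have "?\<gamma> (reach v) \<in> span (?\<gamma> ` reaches extension)"
    by (intro span_base) (simp add: reaches_extension)
  then have "laplacian extension *v ?\<gamma> (reach v) = 0"
    using basis by (simp add: is_right_kernel_basis_def)
  moreover have "?\<gamma> (reach v) $ Inl u = (if u = v then 1 else 0)" for u
    using basis new_vertex_exclusive[of v]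
    by (auto simp: is_right_kernel_basis_def reaches_extension)
  ultimately have "?\<gamma> (reach v) =
      (\<Sum>u\<in>UNIV. (if u = v then 1 else 0) *\<^sub>R harmonic_measure u)"
    using right_kernel_expansion[of "?\<gamma> (reach v)"] by (simp only:)
  then show ?thesis by (simp add: if_distrib[of "\<lambda>a. a *\<^sub>R _"] cong: if_cong)
qed

lemma left_kernel_basis_reach: "left_kernel_basis extension (reach v) = axis (Inl v) 1"
proof -
  let ?l = "left_kernel_basis extension (reach v)"
  have "is_left_kernel_basis extension (left_kernel_basis extension)"
    unfolding left_kernel_basis_def using left_kernel_basis_exists by (rule someI_ex)
  then have supp: "{i. ?l $ i \<noteq> 0} = {Inl v}" and sum: "(\<Sum>i\<in>UNIV. ?l $ i) = 1"
    by (simp_all add: is_left_kernel_basis_def reaches_extension cabal_reach)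
  have zero: "?l $ i = 0" if "i \<noteq> Inl v" for i
    using supp that by blast
  then have "(\<Sum>i\<in>UNIV. ?l $ i) = (\<Sum>i\<in>{Inl v}. ?l $ i)"
    by (intro sum.mono_neutral_right) simp_all
  then have "?l $ Inl v = 1" using sum by simp
  then show ?thesis using zero by (simp add: vec_eq_iff axis_def)
qed

lemma influence_new_vertex:
  "influence extension (Inl v) = (1 + (\<Sum>u\<in>UNIV. absorption $ u $ v)) / (2 * real CARD('v))"
proof -
  have "kernel_projection extension $ x $ Inl v = harmonic_measure v $ x" for x
    by (simp add: kernel_projection_def reaches_extension sum.reindex[OF inj_reach]
        right_kernel_basis_reach left_kernel_basis_reach axis_def
        if_distrib[of "(*) _"] cong: if_cong)
  then have "kernel_projection extension *v axis (Inl v) 1 = harmonic_measure v"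
    by (simp add: vec_eq_iff matrix_vector_mult_basis column_def)
  then show ?thesis
    by (simp add: influence_def inner_vec_def sum_UNIV_Plus)
qed

section \<open>The pagerank equation\<close>

definition absorption_average :: "real ^ 'v" where
  "absorption_average = (1 / real CARD('v)) *\<^sub>R (1 v* absorption)"

lemma probability_vector_absorption_average: "probability_vector absorption_average"
proof -
  have entry: "absorption_average $ v = (\<Sum>u\<in>UNIV. absorption $ u $ v) / real CARD('v)" for v
    by (simp add: absorption_average_def vector_matrix_mult_def)
  have "(\<Sum>v\<in>UNIV. \<Sum>u\<in>UNIV. absorption $ u $ v) = (\<Sum>u\<in>UNIV. \<Sum>v\<in>UNIV. absorption $ u $ v)"
    by (rule sum.swap)
  then show ?thesis
    by (simp add: probability_vector_def entry sum_nonneg absorption_nonneg absorption_row_sum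
        flip: sum_divide_distrib)
qed

lemma pagerank_equation_iff:
  "p = \<beta> *\<^sub>R (p v* S) + ((1 - \<beta>) / real CARD('v)) *\<^sub>R 1 \<longleftrightarrow> p = absorption_average"
  (is "?eq \<longleftrightarrow> _")
proof -
  let ?q = "((1 - \<beta>) / real CARD('v)) *\<^sub>R (1 :: real ^ 'v)"
  have "?eq \<longleftrightarrow> p v* damped_laplacian = ?q"
    by (auto simp: damped_laplacian_vec_mult algebra_simps)
  also have "\<dots> \<longleftrightarrow> p = absorption_average"
  proof
    assume "p v* damped_laplacian = ?q"
    then have "p v* damped_laplacian v* absorption = ?q v* absorption" by simp
    then have "(1 - \<beta>) *\<^sub>R p = (1 - \<beta>) *\<^sub>R absorption_average"
      by (simp add: vector_matrix_mul_assoc damped_laplacian_absorption absorption_average_def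
          vector_scaleR_matrix_ac scaleR_vector_matrix_assoc)
    then show "p = absorption_average" using \<beta>_less_1 by simp
  next
    assume "p = absorption_average"
    then show "p v* damped_laplacian = ?q"
      by (simp add: absorption_average_def vector_matrix_mul_assoc absorption_damped_laplacian
          vector_scaleR_matrix_ac scaleR_vector_matrix_assoc)
  qed
  finally show ?thesis .
qed

end

text \<open>
  A vector of total mass \<open>1\<close> is mapped by the all-ones matrix to the all-ones row vector.  This is why
  the matrix form and the affine form of the pagerank equation agree on probability vectors.
\<close>

lemma probability_vector_teleport:
  fixes p :: "real ^ 'n::finite"
  assumes "probability_vector p"
  shows "p v* (b *\<^sub>R S + c *\<^sub>R all_ones_matrix) = b *\<^sub>R (p v* S) + c *\<^sub>R 1"
proof -
  have "p v* all_ones_matrix = 1"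
    using assms
    by (simp add: vec_eq_iff vector_matrix_mult_def all_ones_matrix_def probability_vector_def)
  then show ?thesis
    by (simp add: vector_matrix_mult_add_rdistrib vector_scaleR_matrix_ac)
qed

theorem corollary6p2:
  fixes E :: "('n::finite \<times> 'n) set"
    and w :: "'n \<Rightarrow> 'n \<Rightarrow> real"
    and S :: "real ^ 'n ^ 'n"
    and \<pi> :: "real ^ 'n"
    and \<alpha> \<beta> :: real
  assumes "weighted_digraph E w"
    and "weakly_connected E"
    and "\<alpha> > 0"
    and "\<beta> = 1 / (1 + \<alpha>)"
    and "S = stochastic_matrix E w"
    and "\<pi> = pagerank \<alpha> E w"
  shows "probability_vector \<pi> \<and>
    \<pi> = \<pi> v* (\<beta> *\<^sub>R S + ((1 - \<beta>) / real CARD('n)) *\<^sub>R all_ones_matrix) \<and>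
    \<pi> v* (\<beta> *\<^sub>R S + ((1 - \<beta>) / real CARD('n)) *\<^sub>R all_ones_matrix) =
      \<beta> *\<^sub>R (\<pi> v* S) + ((1 - \<beta>) / real CARD('n)) *\<^sub>R 1 \<and>
    (\<forall>p. probability_vector p \<and>
       p = p v* (\<beta> *\<^sub>R S + ((1 - \<beta>) / real CARD('n)) *\<^sub>R all_ones_matrix) \<longrightarrow> p = \<pi>) \<and>
    (\<forall>p. probability_vector p \<and>
       p = \<beta> *\<^sub>R (p v* S) + ((1 - \<beta>) / real CARD('n)) *\<^sub>R 1 \<longrightarrow> p = \<pi>)"
proof -
  interpret damped_stochastic S \<beta>
    using assms by unfold_locales
      (auto simp: stochastic_matrix_nonneg stochastic_matrix_row_sum)
  have \<beta>: "\<alpha> / (1 + \<alpha>) = 1 - \<beta>" "1 / (1 + \<alpha>) = \<beta>"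
    using assms(3,4) by (simp_all add: field_simps)
  have ext: "extended_stochastic_matrix \<alpha> E w = extension"
    unfolding vec_eq_iff split_sum_all extended_stochastic_matrix_block[OF assms(1,3)] \<beta>
      assms(5)[symmetric]
    by simp
  have "\<pi> = absorption_average"
    unfolding assms(6) pagerank_def ext influence_new_vertex
    by (simp add: vec_eq_iff absorption_average_def vector_matrix_mult_def add_divide_distrib)
  then have prob: "probability_vector \<pi>"
    and unique: "p = \<beta> *\<^sub>R (p v* S) + ((1 - \<beta>) / real CARD('n)) *\<^sub>R 1 \<longleftrightarrow> p = \<pi>" for p
    using probability_vector_absorption_average pagerank_equation_iff[of p] by simp_all
  have "\<pi> v* (\<beta> *\<^sub>R S + ((1 - \<beta>) / real CARD('n)) *\<^sub>R all_ones_matrix) = \<pi>"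
    using unique[of \<pi>] probability_vector_teleport[OF prob] by simp
  then show ?thesis
    using prob unique probability_vector_teleport by metis
qed

end
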